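(* Let $\rho\in(0,1)$ be irrational with continued fraction convergents $p_n/q_n$, and let $d_n=q_n\rho-p_n$. Then for every $n\ge0$ and every integer $k$ with $0\le k<q_{n+1}$, $$S(q_n+k)=S(q_n)+S(k)+k\,d_n .$$
   Context: $\{t\}=t-\lfloor t\rfloor$ denotes the fractional part. For the fixed $\rho$ and an integer $m\ge0$, $S(m)=\sum_{i=1}^{m}\left(\{i\rho\}-\tfrac12\right)$ (with $S(0)=0$). Write $\rho=[a_1,a_2,\dots]$ for the continued fraction $\rho=1/(a_1+1/(a_2+\cdots))$ with positive integers $a_i$. The convergents $p_n/q_n$ are given by $p_0=0$, $p_1=1$, $q_0=1$, $q_1=a_1$, and $p_{n+1}=a_{n+1}p_n+p_{n-1}$, $q_{n+1}=a_{n+1}q_n+q_{n-1}$ for $n\ge1$. *)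

theory Defs
  imports "HOL-Analysis.Analysis"
begin

text \<open>
  Partial quotients form a sequence \<open>a :: nat \<Rightarrow> nat\<close> read from index 1 on;
  the value \<open>a 0\<close> is never used.
\<close>

text \<open>\<open>cfrac_fin a i m\<close> is \<open>1/(a i + 1/(a (i+1) + \<dots> + 1/a (i+m-1)))\<close>, with value 0 for \<open>m = 0\<close>.\<close>

fun cfrac_fin :: "(nat \<Rightarrow> nat) \<Rightarrow> nat \<Rightarrow> nat \<Rightarrow> real" where
  "cfrac_fin a i 0 = 0"
| "cfrac_fin a i (Suc m) = 1 / (real (a i) + cfrac_fin a (Suc i) m)"

text \<open>
  \<open>\<rho> = [a 1, a 2, \<dots>]\<close>: the value of the infinite continued fraction is the limit of its
  truncations \<open>[a 1, \<dots>, a m]\<close>. Every irrational in the open unit interval has exactly one such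
  expansion (up to the irrelevant \<open>a 0\<close>).
\<close>

definition has_cfrac :: "real \<Rightarrow> (nat \<Rightarrow> nat) \<Rightarrow> bool" where
  "has_cfrac \<rho> a \<longleftrightarrow> (\<forall>i\<ge>1. a i > 0) \<and> (\<lambda>m. cfrac_fin a 1 m) \<longlonglongrightarrow> \<rho>"

fun conv_p :: "(nat \<Rightarrow> nat) \<Rightarrow> nat \<Rightarrow> nat" where
  "conv_p a 0 = 0"
| "conv_p a (Suc 0) = 1"
| "conv_p a (Suc (Suc n)) = a (Suc (Suc n)) * conv_p a (Suc n) + conv_p a n"

fun conv_q :: "(nat \<Rightarrow> nat) \<Rightarrow> nat \<Rightarrow> nat" where
  "conv_q a 0 = 1"
| "conv_q a (Suc 0) = a 1"
| "conv_q a (Suc (Suc n)) = a (Suc (Suc n)) * conv_q a (Suc n) + conv_q a n"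

definition conv_d :: "real \<Rightarrow> (nat \<Rightarrow> nat) \<Rightarrow> nat \<Rightarrow> real" where
  "conv_d \<rho> a n = real (conv_q a n) * \<rho> - real (conv_p a n)"

definition S :: "real \<Rightarrow> nat \<Rightarrow> real" where
  "S \<rho> m = (\<Sum>i=1..m. (frac (real i * \<rho>) - 1/2))"

end

theory Submission
  imports Defs
begin

text \<open>
  It suffices that \<open>frac ((q n + i) \<rho>) = frac (i \<rho>) + d n\<close> for \<open>0 < i < q (n+1)\<close>, i.e. that no
  integer \<open>m\<close> separates \<open>i \<rho>\<close> from \<open>i \<rho> + d n\<close>. As consecutive convergents form a unimodular
  matrix, \<open>i = x q n + y q (n+1)\<close> and \<open>m = x p n + y p (n+1)\<close> with integers \<open>x\<close>, \<open>y\<close>, so that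
  \<open>i \<rho> - m = x d n + y d (n+1)\<close>. The signs of the \<open>d n\<close> alternate; if \<open>i \<rho> - m\<close> has the sign
  opposite to \<open>d n\<close>, then the bounds on \<open>i\<close> force \<open>x < 0 < y\<close>, and therefore
  \<open>\<bar>i \<rho> - m\<bar> > \<bar>d n\<bar>\<close>.
\<close>

lemma cfrac_fin_nonneg: "0 \<le> cfrac_fin a i m"
  by (induction m arbitrary: i) auto

lemma conv_q_pos:
  assumes "\<forall>i\<ge>1. a i > 0"
  shows "conv_q a n > 0"
  using assms by (induction a n rule: conv_q.induct) auto

lemma conv_det:
  "int (conv_q a n) * int (conv_p a (Suc n)) - int (conv_p a n) * int (conv_q a (Suc n)) = (- 1) ^ n"
proof (induction n)
  case (Suc n)
  then show ?case by (simp add: algebra_simps)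
qed simp

text \<open>Peeling one quotient \<open>b\<close> off the tail turns the ratio of successive
  \<open>conv_d\<close> into \<open>- 1 / (b + t)\<close>; the recurrence of \<open>conv_d\<close>
  then makes the next ratio \<open>- t\<close>.\<close>

lemma conv_d_cfrac_fin_Suc:
  fixes a :: "nat \<Rightarrow> nat"
  assumes pos: "\<forall>i\<ge>1. a i > 0"
  shows "conv_d (cfrac_fin a 1 (Suc n + j)) a (Suc n) =
    - cfrac_fin a (Suc (Suc n)) j * conv_d (cfrac_fin a 1 (Suc n + j)) a n"
proof (induction n arbitrary: j)
  case 0
  have "real (a 1) + cfrac_fin a 2 j > 0"
    using pos[rule_format, of 1] cfrac_fin_nonneg[of a 2 j] by simp
  then show ?case by (simp add: conv_d_def field_simps numeral_2_eq_2)
next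
  case (Suc n)
  define r t b where "r = cfrac_fin a 1 (Suc (Suc n) + j)"
    and "t = cfrac_fin a (Suc (Suc (Suc n))) j" and "b = real (a (Suc (Suc n)))"
  have "b + t > 0"
    using pos[rule_format, of "Suc (Suc n)"] cfrac_fin_nonneg[of a "Suc (Suc (Suc n))" j]
    by (simp add: b_def t_def)
  moreover have "conv_d r a (Suc n) = - (1 / (b + t)) * conv_d r a n"
    using Suc[of "Suc j"] by (simp add: r_def t_def b_def)
  ultimately have "conv_d r a n = - (b + t) * conv_d r a (Suc n)"
    by (simp add: field_simps)
  moreover have "conv_d r a (Suc (Suc n)) = b * conv_d r a (Suc n) + conv_d r a n"
    by (simp add: conv_d_def b_def algebra_simps)
  ultimately have "conv_d r a (Suc (Suc n)) = - t * conv_d r a (Suc n)"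
    by (simp add: algebra_simps)
  then show ?case by (simp only: r_def t_def)
qed

text \<open>Each step multiplies by minus a tail, which is nonnegative. The inequality is weak since
  the empty tail is 0.\<close>

lemma conv_d_cfrac_fin_sign:
  fixes a :: "nat \<Rightarrow> nat"
  assumes pos: "\<forall>i\<ge>1. a i > 0"
  shows "0 \<le> (- 1) ^ n * conv_d (cfrac_fin a 1 (n + j)) a n"
proof (induction n arbitrary: j)
  case 0
  show ?case by (simp add: conv_d_def cfrac_fin_nonneg)
next
  case (Suc n)
  have "(- 1) ^ Suc n * conv_d (cfrac_fin a 1 (Suc n + j)) a (Suc n) =
      cfrac_fin a (Suc (Suc n)) j * ((- 1) ^ n * conv_d (cfrac_fin a 1 (n + Suc j)) a n)"
    using conv_d_cfrac_fin_Suc[OF pos, of n j]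
    by (simp del: cfrac_fin.simps)
  then show ?case using Suc[of "Suc j"] cfrac_fin_nonneg by (metis mult_nonneg_nonneg)
qed

lemma irrational_linear_nonzero:
  fixes \<rho> :: real
  assumes "\<rho> \<notin> \<rat>" and "i > 0"
  shows "real i * \<rho> \<noteq> of_int m"
proof
  assume "real i * \<rho> = of_int m"
  then have "\<rho> = of_int m / of_nat i" using assms(2) by (simp add: field_simps)
  then have "\<rho> \<in> \<rat>" by simp
  with assms(1) show False by contradiction
qed

text \<open>For fixed \<open>n\<close>, \<open>conv_d\<close> is affine in its real argument, so the
  weak sign passes from the truncations to their limit; irrationality makes it strict.\<close>

lemma conv_d_sign:
  assumes irr: "\<rho> \<notin> \<rat>" and cf: "has_cfrac \<rho> a"
  shows "0 < (- 1) ^ n * conv_d \<rho> a n"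
proof -
  have pos: "\<forall>i\<ge>1. a i > 0" and lim: "cfrac_fin a 1 \<longlonglongrightarrow> \<rho>"
    using cf by (auto simp: has_cfrac_def)
  have "(\<lambda>j. (- 1) ^ n * conv_d (cfrac_fin a 1 (j + n)) a n) \<longlonglongrightarrow> (- 1) ^ n * conv_d \<rho> a n"
    unfolding conv_d_def by (intro tendsto_intros LIMSEQ_ignore_initial_segment[OF lim])
  moreover have "0 \<le> (- 1) ^ n * conv_d (cfrac_fin a 1 (j + n)) a n" for j
    using conv_d_cfrac_fin_sign[OF pos, of n j] by (simp add: add.commute)
  ultimately have "0 \<le> (- 1) ^ n * conv_d \<rho> a n"
    by (blast intro: LIMSEQ_le_const)
  moreover have "conv_d \<rho> a n \<noteq> 0"
    using irrational_linear_nonzero[OF irr, of "conv_q a n" "int (conv_p a n)"] conv_q_pos[OF pos, of n]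
    by (simp add: conv_d_def)
  then have "(- 1) ^ n * conv_d \<rho> a n \<noteq> 0"
    by simp
  ultimately show ?thesis by linarith
qed

lemma conv_d_separation:
  fixes \<rho> :: real and m :: int
  assumes irr: "\<rho> \<notin> \<rat>" and cf: "has_cfrac \<rho> a"
    and i: "0 < i" "i < conv_q a (Suc n)"
    and opp: "(- 1) ^ n * (real i * \<rho> - of_int m) < 0"
  shows "(- 1) ^ n * (real i * \<rho> - of_int m + conv_d \<rho> a n) < 0"
proof -
  define s :: int where "s = (- 1) ^ n"
  define q q' p p' where "q = int (conv_q a n)" and "q' = int (conv_q a (Suc n))"
    and "p = int (conv_p a n)" and "p' = int (conv_p a (Suc n))"
  \<comment> \<open>Cramer's rule; multiplying by \<open>s\<close> replaces division by the
    determinant \<open>s\<close>, as \<open>s * s = 1\<close>.\<close>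
  define x y where "x = s * (int i * p' - m * q')" and "y = s * (m * q - int i * p)"
  \<comment> \<open>Absolute values of the two consecutive \<open>conv_d\<close>: the alternating
    signs are absorbed, which treats both parities of \<open>n\<close> at once.\<close>
  define D E where "D = of_int s * conv_d \<rho> a n" and "E = - of_int s * conv_d \<rho> a (Suc n)"
  have D: "D > 0" and E: "E > 0"
    using conv_d_sign[OF irr cf, of n] conv_d_sign[OF irr cf, of "Suc n"]
    by (simp_all add: D_def E_def s_def)
  have det: "q * p' - p * q' = s"
    using conv_det[of a n] by (simp add: q_def q'_def p_def p'_def s_def)
  have ss: "s * s = 1" by (simp add: s_def flip: power_add)
  have "x * q + y * q' = int i * (s * (q * p' - p * q'))"
    by (simp add: x_def y_def algebra_simps)
  then have xi: "x * q + y * q' = int i" by (simp add: det ss)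
  have "x * p + y * p' = m * (s * (q * p' - p * q'))"
    by (simp add: x_def y_def algebra_simps)
  then have xm: "x * p + y * p' = m" by (simp add: det ss)
  have "of_int s * (real i * \<rho> - of_int m) =
      of_int s * (of_int (x * q + y * q') * \<rho> - of_int (x * p + y * p'))"
    by (simp add: xi xm)
  also have "\<dots> = of_int x * D - of_int y * E"
    by (simp add: D_def E_def conv_d_def q_def q'_def p_def p'_def algebra_simps)
  finally have eq: "of_int s * (real i * \<rho> - of_int m) = of_int x * D - of_int y * E" .
  then have neg: "of_int x * D - of_int y * E < 0"
    using opp by (simp add: s_def)
  have q: "q \<ge> 0" "q' > 0" "int i < q'" using i by (auto simp: q_def q'_def)
  have x: "x < 0"
  proof (rule ccontr)
    assume "\<not> x < 0"
    then have x0: "x \<ge> 0" by simp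
    \<comment> \<open>With \<open>x \<ge> 0\<close>, negativity of \<open>x D - y E\<close> needs a
      positive \<open>y\<close>, and then \<open>i \<ge> q'\<close>, against the bound on
      \<open>i\<close>.\<close>
    have "y \<ge> 1"
    proof (rule ccontr)
      assume "\<not> y \<ge> 1"
      then have "of_int y * E \<le> 0" using E by (simp add: mult_le_0_iff)
      moreover have "of_int x * D \<ge> 0" using x0 D by simp
      ultimately show False using neg by linarith
    qed
    then have "y * q' \<ge> q'" using q by simp
    moreover have "x * q \<ge> 0" using x0 q by simp
    ultimately show False using xi q by linarith
  qed
  have "x * q \<le> 0" using x q by (simp add: mult_le_0_iff)
  then have "y * q' > 0" using xi i by linarith
  then have "y > 0" using q by (simp add: zero_less_mult_iff)
  then have "of_int y * E > 0" using E by simp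
  \<comment> \<open>Integrality of \<open>x\<close> leaves room for one extra
    \<open>D\<close>.\<close>
  moreover have "of_int (x + 1) * D \<le> 0" using x D by (intro mult_nonpos_nonneg) auto
  ultimately have "of_int x * D - of_int y * E + D < 0" by (simp add: algebra_simps)
  then show ?thesis using eq by (simp add: D_def s_def algebra_simps)
qed

lemma frac_conv_q_add:
  fixes \<rho> :: real
  assumes irr: "\<rho> \<notin> \<rat>" and cf: "has_cfrac \<rho> a"
    and i: "0 < i" "i < conv_q a (Suc n)"
  shows "frac (real (conv_q a n + i) * \<rho>) = frac (real i * \<rho>) + conv_d \<rho> a n"
proof -
  let ?z = "real i * \<rho>" and ?d = "conv_d \<rho> a n"
  \<comment> \<open>Irrationality makes the lower bound strict too, as
    \<open>conv_d_separation\<close> requires.\<close>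
  have z: "of_int \<lfloor>?z\<rfloor> < ?z" "?z < of_int (\<lfloor>?z\<rfloor> + 1)"
    using irrational_linear_nonzero[OF irr i(1), of "\<lfloor>?z\<rfloor>"] by linarith+
  have "of_int \<lfloor>?z\<rfloor> \<le> ?z + ?d \<and> ?z + ?d < of_int \<lfloor>?z\<rfloor> + 1"
  \<comment> \<open>The sign of \<open>?d\<close> decides which neighbouring integer could be
    crossed: the upper one for even \<open>n\<close>, the lower one for odd
    \<open>n\<close>.\<close>
  proof (cases "even n")
    case True
    then have "?d > 0" using conv_d_sign[OF irr cf, of n] by simp
    moreover have "?z + ?d < of_int (\<lfloor>?z\<rfloor> + 1)"
      using conv_d_separation[OF irr cf i, of "\<lfloor>?z\<rfloor> + 1"] True z by simp
    ultimately show ?thesis using z by linarith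
  next
    case False
    then have "?d < 0" using conv_d_sign[OF irr cf, of n] by simp
    moreover have "?z + ?d > of_int \<lfloor>?z\<rfloor>"
      using conv_d_separation[OF irr cf i, of "\<lfloor>?z\<rfloor>"] False z by simp
    ultimately show ?thesis using z by linarith
  qed
  moreover have "real (conv_q a n + i) * \<rho> = ?z + ?d + of_int (int (conv_p a n))"
    by (simp add: conv_d_def algebra_simps)
  ultimately have "\<lfloor>real (conv_q a n + i) * \<rho>\<rfloor> = \<lfloor>?z\<rfloor> + int (conv_p a n)"
    by (intro floor_unique) auto
  then show ?thesis by (simp add: frac_def conv_d_def algebra_simps)
qed

lemma S_Suc: "S \<rho> (Suc m) = S \<rho> m + (frac (real (Suc m) * \<rho>) - 1/2)"
  by (simp add: S_def)

theorem proposition6p2: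
  fixes \<rho> :: real and a :: "nat \<Rightarrow> nat" and n k :: nat
  assumes "0 < \<rho>" and "\<rho> < 1" and "\<rho> \<notin> \<rat>"
    and "has_cfrac \<rho> a"
    and "k < conv_q a (n + 1)"
  shows "S \<rho> (conv_q a n + k) = S \<rho> (conv_q a n) + S \<rho> k + real k * conv_d \<rho> a n"
  using assms(5)
proof (induction k)
  case 0
  show ?case by (simp add: S_def)
next
  case (Suc k)
  \<comment> \<open>The new summand has index \<open>Suc k\<close>, which is positive and below
    \<open>conv_q a (Suc n)\<close>; it contributes one further \<open>conv_d\<close>.\<close>
  have "frac (real (conv_q a n + Suc k) * \<rho>) = frac (real (Suc k) * \<rho>) + conv_d \<rho> a n"
    using frac_conv_q_add[OF assms(3,4), of "Suc k" n] Suc.prems by simp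
  moreover have "S \<rho> (conv_q a n + k) = S \<rho> (conv_q a n) + S \<rho> k + real k * conv_d \<rho> a n"
    using Suc by simp
  ultimately show ?case
    unfolding add_Suc_right S_Suc by (simp add: algebra_simps)
qed

end
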